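(* Let $4>u>\theta>0$ and $c,C>0$. There is $\alpha=\alpha(u,C,\theta,c)$ such that if $f_1,\ldots,f_m:\mathbb{R}\to\mathbb{R}_+$ are each lower $\theta$-homogeneous with constant $c$ and upper $u$-homogeneous with constant $C$, then for every choice of nonzero vectors $a_1,\ldots,a_m\in\mathbb{R}^n$ spanning $\mathbb{R}^n$, there is an $\alpha$-approximate weight scheme $\{w^{(j)}:j\in\mathbb{Z}\}$.
   Context: $f$ is lower $\theta$-homogeneous with constant $c$ if $f(\lambda z)\ge c\lambda^\theta f(z)$ for all $z\in\mathbb{R}$, $\lambda\ge1$; upper $u$-homogeneous with constant $C$ if $f(\lambda z)\le C\lambda^uf(z)$ for all $z$, $\lambda\ge1$. For $w\in\mathbb{R}_+^m$, $M_w:=\sum_jw_ja_ja_j^\top$; $w$ is an $\alpha$-approximate weight at scale $s$ if $M_w$ is invertible, $w_i>0$, and $s/\alpha\le f_i(\|M_w^{-1/2}a_i\|_2)/(w_i\|M_w^{-1/2}a_i\|_2^2)\le\alpha s$ for all $i$. For a set $\mathcal{J}\subseteq\mathbb{Z}$ of consecutive integers, a family $\{w^{(j)}\in\mathbb{R}_+^m:j\in\mathcal{J}\}$ is an $\alpha$-approximate weight scheme if each $w^{(j)}$ is an $\alpha$-approximate weight at scale $2^j$ and $w^{(j+1)}_i\le\alpha w^{(j)}_i$ for all $i$ and all $j$ with $j,j+1\in\mathcal{J}$.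
   Formalization: Each f_i is additionally assumed to be nonzero at some point of (0,∞); without this the claim fails, since f_i = 0 satisfies both homogeneity conditions but admits no approximate weight. *)

theory Defs
  imports Complex_Main "Jordan_Normal_Form.VS_Connect"
begin

text \<open>
  Vectors and matrices have explicit dimensions, so that a constant can be chosen
  before the dimension \<open>n\<close> and the number \<open>m\<close> of vectors are.
  Families indexed by \<open>1, \<dots>, m\<close> are functions on \<open>nat\<close>, relevant at \<open>i < m\<close> only.
\<close>

definition lower_homogeneous :: "real \<Rightarrow> real \<Rightarrow> (real \<Rightarrow> real) \<Rightarrow> bool" where
  "lower_homogeneous \<theta> c f \<longleftrightarrow> (\<forall>z. \<forall>t\<ge>1. f (t * z) \<ge> c * t powr \<theta> * f z)"

definition upper_homogeneous :: "real \<Rightarrow> real \<Rightarrow> (real \<Rightarrow> real) \<Rightarrow> bool" where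
  "upper_homogeneous u C f \<longleftrightarrow> (\<forall>z. \<forall>t\<ge>1. f (t * z) \<le> C * t powr u * f z)"

definition norm2 :: "real vec \<Rightarrow> real" where
  "norm2 v = sqrt (v \<bullet> v)"

definition psd_mat :: "nat \<Rightarrow> real mat \<Rightarrow> bool" where
  "psd_mat n B \<longleftrightarrow> B \<in> carrier_mat n n \<and> transpose_mat B = B \<and>
     (\<forall>x \<in> carrier_vec n. 0 \<le> x \<bullet> (B *\<^sub>v x))"

text \<open>
  \<open>M\<^bsup>-1/2\<^esup>\<close> is the positive semidefinite square root of the inverse of \<open>M\<close>. It exists and
  is unique for positive definite \<open>M\<close>, so the choice operator has a single candidate there.
\<close>

definition inv_sqrt_mat :: "real mat \<Rightarrow> real mat" where
  "inv_sqrt_mat M = (SOME B. psd_mat (dim_row M) B \<and>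
     inverts_mat M (B * B) \<and> inverts_mat (B * B) M)"

text \<open>Entrywise form of \<open>M\<^sub>w = \<Sum>\<^sub>k w\<^sub>k a\<^sub>k a\<^sub>k\<^sup>T\<close>: matrices of unspecified
  dimension are not an additive monoid, so the overloaded sum is unavailable for them.\<close>

definition weight_mat :: "nat \<Rightarrow> nat \<Rightarrow> (nat \<Rightarrow> real vec) \<Rightarrow> (nat \<Rightarrow> real) \<Rightarrow> real mat" where
  "weight_mat m n a w = mat n n (\<lambda>(r, s). \<Sum>k<m. w k * (a k $ r) * (a k $ s))"

definition approx_weight ::
  "nat \<Rightarrow> nat \<Rightarrow> (nat \<Rightarrow> real \<Rightarrow> real) \<Rightarrow> (nat \<Rightarrow> real vec) \<Rightarrow> real \<Rightarrow> real \<Rightarrow> (nat \<Rightarrow> real) \<Rightarrow> bool"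
where
  "approx_weight m n f a \<alpha> s w \<longleftrightarrow>
     invertible_mat (weight_mat m n a w) \<and>
     (\<forall>i<m. w i > 0 \<and>
        (let x = norm2 (inv_sqrt_mat (weight_mat m n a w) *\<^sub>v a i)
         in s / \<alpha> \<le> f i x / (w i * x\<^sup>2) \<and> f i x / (w i * x\<^sup>2) \<le> \<alpha> * s))"

definition consecutive_ints :: "int set \<Rightarrow> bool" where
  "consecutive_ints J \<longleftrightarrow> (\<forall>i\<in>J. \<forall>k\<in>J. {i..k} \<subseteq> J)"

definition approx_weight_scheme ::
  "nat \<Rightarrow> nat \<Rightarrow> (nat \<Rightarrow> real \<Rightarrow> real) \<Rightarrow> (nat \<Rightarrow> real vec) \<Rightarrow> real \<Rightarrow> int set \<Rightarrow> (int \<Rightarrow> nat \<Rightarrow> real) \<Rightarrow> bool"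
where
  "approx_weight_scheme m n f a \<alpha> J w \<longleftrightarrow>
     consecutive_ints J \<and>
     (\<forall>j\<in>J. approx_weight m n f a \<alpha> (2 powi j) (w j)) \<and>
     (\<forall>j. j \<in> J \<and> j + 1 \<in> J \<longrightarrow> (\<forall>i<m. w (j + 1) i \<le> \<alpha> * w j i))"

text \<open>
  The zero function satisfies both homogeneity conditions, but an approximate weight can only
  exist if no \<open>f\<^sub>i\<close> vanishes on the whole of the positive half-line (the only part on which
  \<open>f\<^sub>i\<close> is evaluated). Conversely, under the two homogeneity conditions a nonnegative
  function that is nonzero somewhere on the half-line is positive on all of it.
\<close>

lemma approx_weight_imp_nonzero:
  assumes "approx_weight m n f a \<alpha> s w" "\<alpha> > 0" "s > 0" "i < m"
  shows "\<exists>z>0. f i z \<noteq> 0"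
proof -
  define x where "x = norm2 (inv_sqrt_mat (weight_mat m n a w) *\<^sub>v a i)"
  have "0 < s / \<alpha>" using assms by simp
  also have "s / \<alpha> \<le> f i x / (w i * x\<^sup>2)"
    using assms by (simp add: approx_weight_def Let_def x_def)
  finally have "f i x \<noteq> 0" "x \<noteq> 0" by auto
  moreover have "x \<ge> 0"
    by (auto simp: x_def norm2_def scalar_prod_def intro!: sum_nonneg)
  ultimately show ?thesis by (intro exI[of _ x]) simp
qed

end

theory Submission
  imports Defs "Jordan_Normal_Form.Jordan_Normal_Form_Existence"
begin

text \<open>
  Put \<open>\<tau>\<^sub>i(w) = \<parallel>M\<^sub>w\<^bsup>-1/2\<^esup>a\<^sub>i\<parallel>\<^sup>2\<close> and measure weights in the metric \<open>max\<^sub>i \<bar>ln w\<^sub>i - ln v\<^sub>i\<bar>\<close>.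
  An approximate weight at scale \<open>s\<close> is an approximate fixed point of
  \<open>w \<mapsto> (f\<^sub>i(\<surd>\<tau>\<^sub>i(w)) / (s \<tau>\<^sub>i(w)))\<^sub>i\<close>. Each \<open>\<tau>\<^sub>i\<close> is 1-Lipschitz because it is antitone and
  homogeneous of degree \<open>-1\<close>, and \<open>f\<^sub>i(\<surd>\<tau>)/\<tau>\<close> has exponents between \<open>\<theta>/2 - 1 > -1\<close> and
  \<open>u/2 - 1 < 1\<close> (this is where \<open>u < 4\<close> enters), so the map is a contraction up to an additive
  constant. Hence finitely many iterations reach an approximate fixed point, without any
  continuity of the \<open>f\<^sub>i\<close>. Doubling \<open>s\<close> moves the map by \<open>ln 2\<close> only, so by the same contraction any
  two approximate fixed points at adjacent scales are close: the weights can be chosen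
  independently for all \<open>j\<close>.
\<close>

section \<open>Square roots of positive definite matrices\<close>

text \<open>Induction peels off the first block. The equal diagonal entries ensure that a
  superdiagonal 1 links two columns with the same eigenvalue, which later yields a generalized
  eigenvector.\<close>

lemma jordan_matrix_off_diagonal:
  assumes "i < sum_list (map fst n_as)" "j < sum_list (map fst n_as)" "i \<noteq> j"
    and "jordan_matrix n_as $$ (i, j) \<noteq> 0"
  shows "j = Suc i \<and> jordan_matrix n_as $$ (j, j) = jordan_matrix n_as $$ (i, i)
    \<and> jordan_matrix n_as $$ (i, j) = 1"
  using assms
proof (induction n_as arbitrary: i j)
  case Nil
  then show ?case by simp
next
  case (Cons p n_as)
  obtain n a where p: "p = (n, a)" by force
  have *: "jordan_matrix n_as $$ (j - n, j - n) = jordan_matrix n_as $$ (i - n, i - n) \<and>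
      j - n = Suc (i - n) \<and> jordan_matrix n_as $$ (i - n, j - n) = 1"
    if "\<not> i < n" "\<not> j < n" "jordan_matrix n_as $$ (i - n, j - n) \<noteq> 0"
    using Cons.IH[of "i - n" "j - n"] Cons.prems that p by auto
  show ?case
    using Cons.prems * unfolding p jordan_matrix_Cons
    by (auto split: if_splits)
qed

lemma scalar_prod_symmetric_mat:
  fixes A :: "'a :: comm_semiring_0 mat"
  assumes "A \<in> carrier_mat n n" "transpose_mat A = A" "x \<in> carrier_vec n" "y \<in> carrier_vec n"
  shows "(A *\<^sub>v x) \<bullet> y = x \<bullet> (A *\<^sub>v y)"
  using transpose_vec_mult_scalar[OF assms(1) assms(4) assms(3)] assms(2) by simp

text \<open>Pairing \<open>A v\<close> with the conjugate of \<open>v\<close> and moving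
  \<open>A\<close> across shows that \<open>e\<close> and \<open>cnj e\<close> agree after
  multiplication by the nonzero number \<open>v \<bullet>c v\<close>.\<close>

lemma symmetric_eigenvalue_real:
  fixes A :: "real mat"
  assumes A: "A \<in> carrier_mat n n" and sym: "transpose_mat A = A"
    and ev: "eigenvalue (map_mat complex_of_real A) e"
  shows "e \<in> \<real>"
proof -
  let ?A = "map_mat complex_of_real A"
  have cA: "?A \<in> carrier_mat n n" using A by simp
  have symc: "transpose_mat ?A = ?A"
  proof (rule eq_matI)
    fix i j assume "i < dim_row ?A" "j < dim_col ?A"
    then show "transpose_mat ?A $$ (i, j) = ?A $$ (i, j)"
      using arg_cong[OF sym, of "\<lambda>B. B $$ (i, j)"] A by auto
  qed (use A in auto)
  from ev obtain v where v: "v \<in> carrier_vec n" "v \<noteq> 0\<^sub>v n" "?A *\<^sub>v v = e \<cdot>\<^sub>v v"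
    using A unfolding eigenvalue_def eigenvector_def by auto
  have "conjugate (?A *\<^sub>v v) = ?A *\<^sub>v conjugate v"
    by (rule eq_vecI) (use A v(1) in \<open>auto simp: scalar_prod_def\<close>)
  then have conj: "?A *\<^sub>v conjugate v = cnj e \<cdot>\<^sub>v conjugate v"
    using v(3) by (auto simp: conjugate_smult_vec)
  have "(?A *\<^sub>v v) \<bullet> conjugate v = v \<bullet> (?A *\<^sub>v conjugate v)"
    by (rule scalar_prod_symmetric_mat[OF cA symc]) (use v in auto)
  then have "e * (v \<bullet>c v) = cnj e * (v \<bullet>c v)"
    unfolding conj v(3) using v by simp
  moreover have "v \<bullet>c v \<noteq> 0" using v conjugate_square_eq_0_vec by blast
  ultimately show ?thesis by (auto simp: complex_is_Real_iff complex_eq_iff)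
qed

text \<open>A real Jordan form requires a split characteristic polynomial. Over the complex numbers
  it splits with real roots, and the embedding of real polynomials is injective, so the
  factorization descends.\<close>

lemma symmetric_char_poly_splits:
  fixes A :: "real mat"
  assumes A: "A \<in> carrier_mat n n" and sym: "transpose_mat A = A"
  shows "\<exists>es. char_poly A = (\<Prod>e\<leftarrow>es. [:- e, 1:])"
proof -
  let ?A = "map_mat complex_of_real A"
  have cA: "?A \<in> carrier_mat n n" using A by simp
  obtain es where es: "char_poly ?A = (\<Prod>e\<leftarrow>es. [:- e, 1:])"
    using char_poly_factorized[OF cA] by auto
  have real: "e \<in> \<real>" if "e \<in> set es" for e
  proof (rule symmetric_eigenvalue_real[OF A sym])
    show "eigenvalue ?A e"
      unfolding eigenvalue_root_char_poly[OF cA] es using that by (auto simp: poly_prod_list prod_list_zero_iff image_iff)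
  qed
  interpret map_poly_hom: map_poly_inj_idom_hom complex_of_real ..
  have "map_poly complex_of_real (char_poly A) = (\<Prod>e\<leftarrow>es. [:- e, 1:])"
    using of_real_hom.char_poly_hom[OF A, where ?'a = complex] es by simp
  also have "map (\<lambda>e. [:- e, 1:]) es
      = map (map_poly complex_of_real) (map (\<lambda>e. [:- e, 1:]) (map Re es))"
    using real by (auto simp: of_real_Re)
  also have "prod_list \<dots> = map_poly complex_of_real (\<Prod>e\<leftarrow>map Re es. [:- e, 1:])"
    by (simp only: map_poly_hom.hom_prod_list)
  finally show ?thesis by (auto simp only: map_poly_hom.eq_iff)
qed

text \<open>A spectral theorem without orthogonality: the Jordan form exists, and symmetry rules out
  blocks of size above one.\<close>

lemma symmetric_diagonalization:
  fixes A :: "real mat"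
  assumes A: "A \<in> carrier_mat n n" and sym: "transpose_mat A = A"
  obtains P Q J where "similar_mat_wit A J P Q" "diagonal_mat J"
proof -
  obtain es where "char_poly A = (\<Prod>e\<leftarrow>es. [:- e, 1:])"
    using symmetric_char_poly_splits[OF A sym] by blast
  from jordan_nf_exists[OF A this] obtain n_as where "jordan_nf A n_as" by blast
  then obtain P Q where wit: "similar_mat_wit A (jordan_matrix n_as) P Q"
    unfolding jordan_nf_def similar_mat_def by blast
  define J where "J = jordan_matrix n_as"
  note w = similar_mat_witD2[OF A wit, folded J_def]
  have n: "sum_list (map fst n_as) = n"
    using w(5) by (metis J_def carrier_matD(1) jordan_matrix_dim(1))
  \<comment> \<open>A first off-diagonal entry \<open>J(i, i+1) = 1\<close> gives an eigenvector \<open>x\<close> and a \<open>y\<close> with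
    \<open>A y = l y + x\<close>; then symmetry forces \<open>x \<bullet> x = 0\<close>.\<close>
  have "J $$ (i, j) = 0" if "i < n" "j < n" "i \<noteq> j" for i j
    using that
  proof (induction i arbitrary: j rule: less_induct)
    case (less i)
    show ?case
    proof (rule ccontr)
      assume "J $$ (i, j) \<noteq> 0"
      then have j: "j = Suc i" "J $$ (j, j) = J $$ (i, i)" "J $$ (i, j) = 1"
        using jordan_matrix_off_diagonal[of i n_as j] less.prems unfolding J_def n by auto
      let ?l = "J $$ (i, i)"
      have coli: "J *\<^sub>v unit_vec n i = ?l \<cdot>\<^sub>v unit_vec n i"
      proof (rule eq_vecI)
        fix k assume "k < dim_vec (?l \<cdot>\<^sub>v unit_vec n i)"
        then have k: "k < n" by simp
        \<comment> \<open>An off-diagonal entry of column \<open>i\<close> would lie in row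
          \<open>i - 1\<close>, which the induction has already cleared; hence
          \<open>unit_vec n i\<close> is a true eigenvector of \<open>J\<close>.\<close>
        have "J $$ (k, i) = 0" if "k \<noteq> i"
        proof (rule ccontr)
          assume "J $$ (k, i) \<noteq> 0"
          then have "i = Suc k"
            using jordan_matrix_off_diagonal[of k n_as i] less.prems k that unfolding J_def n by auto
          then show False using less.IH[of k i] \<open>J $$ (k, i) \<noteq> 0\<close> less.prems k by auto
        qed
        then show "(J *\<^sub>v unit_vec n i) $ k = (?l \<cdot>\<^sub>v unit_vec n i) $ k"
          using k less.prems w(5) by auto
      qed (use w(5) in auto)
      have colj: "J *\<^sub>v unit_vec n j = ?l \<cdot>\<^sub>v unit_vec n j + unit_vec n i"
      proof (rule eq_vecI)
        fix k assume "k < dim_vec (?l \<cdot>\<^sub>v unit_vec n j + unit_vec n i)"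
        then have k: "k < n" by simp
        have "J $$ (k, j) = 0" if "k \<noteq> j" "k \<noteq> i"
          using jordan_matrix_off_diagonal[of k n_as j] less.prems k that j unfolding J_def n by auto
        then show "(J *\<^sub>v unit_vec n j) $ k = (?l \<cdot>\<^sub>v unit_vec n j + unit_vec n i) $ k"
          using k less.prems w(5) j by (auto simp: add_scalar_prod_distrib)
      qed (use w(5) in auto)
      define x where "x = P *\<^sub>v unit_vec n i"
      define y where "y = P *\<^sub>v unit_vec n j"
      have xy: "x \<in> carrier_vec n" "y \<in> carrier_vec n"
        unfolding x_def y_def using w(6) by auto
      have AP: "A *\<^sub>v (P *\<^sub>v z) = P *\<^sub>v (J *\<^sub>v z)" if z: "z \<in> carrier_vec n" for z
      proof -
        have "Q *\<^sub>v (P *\<^sub>v z) = z"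
          using w(2,6,7) z by (simp add: assoc_mult_mat_vec[symmetric, of _ n n _ n])
        then show ?thesis
          unfolding w(3) using w(5-7) z by (simp add: assoc_mult_mat_vec[of _ n n _ n])
      qed
      have Ax: "A *\<^sub>v x = ?l \<cdot>\<^sub>v x"
        unfolding x_def by (subst AP) (use w(6) in \<open>auto simp: coli mult_mat_vec\<close>)
      have Ay: "A *\<^sub>v y = ?l \<cdot>\<^sub>v y + x"
        unfolding x_def y_def
        by (subst AP) (use w(6) in \<open>auto simp: colj mult_mat_vec mult_add_distrib_mat_vec[of _ n n]\<close>)
      have "(A *\<^sub>v x) \<bullet> y = x \<bullet> (A *\<^sub>v y)"
        by (rule scalar_prod_symmetric_mat[OF A sym xy])
      then have "x \<bullet> x = 0"
        unfolding Ax Ay using xy by (simp add: scalar_prod_add_distrib[of _ n])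
      then have "x = 0\<^sub>v n" using conjugate_square_eq_0_vec[OF xy(1)] xy by (simp add: conjugate_vec_def)
      then have "Q *\<^sub>v x = 0\<^sub>v n" using w(7) by (intro eq_vecI) auto
      moreover have "Q *\<^sub>v x = unit_vec n i"
        unfolding x_def using w(2,6,7) by (simp add: assoc_mult_mat_vec[symmetric, of _ n n _ n])
      ultimately show False using less.prems
        by (metis index_unit_vec(1) index_zero_vec(1) zero_neq_one)
    qed
  qed
  then have "diagonal_mat J" using w(5) unfolding diagonal_mat_def by auto
  then show ?thesis using that wit unfolding J_def by blast
qed

section \<open>Inverse square roots by functional calculus\<close>

lemma symmetric_mult_self_psd:
  assumes B: "B \<in> carrier_mat n n" and sym: "transpose_mat B = B"
  shows "psd_mat n (B * B)"
  unfolding psd_mat_def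
proof (intro conjI ballI)
  show "B * B \<in> carrier_mat n n" using B by simp
  show "transpose_mat (B * B) = B * B" using B sym by (simp add: transpose_mult[of _ n n _ n])
  fix x :: "real vec" assume x: "x \<in> carrier_vec n"
  have "x \<bullet> (B * B *\<^sub>v x) = (B *\<^sub>v x) \<bullet> (B *\<^sub>v x)"
    using scalar_prod_symmetric_mat[OF B sym x, of "B *\<^sub>v x"] B x by (simp add: assoc_mult_mat_vec[of _ n n _ n])
  also have "\<dots> \<ge> 0" by (auto simp: scalar_prod_def intro: sum_nonneg)
  finally show "0 \<le> x \<bullet> (B * B *\<^sub>v x)" .
qed

definition pos_def_mat :: "nat \<Rightarrow> real mat \<Rightarrow> bool" where
  "pos_def_mat n M \<longleftrightarrow> M \<in> carrier_mat n n \<and> transpose_mat M = M \<and>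
     (\<forall>x \<in> carrier_vec n. x \<noteq> 0\<^sub>v n \<longrightarrow> 0 < x \<bullet> (M *\<^sub>v x))"

text \<open>Applying \<open>g\<close> to the eigenvalues gives a multiplicative map
  \<open>g \<mapsto> F g\<close> that sends the identity to \<open>M\<close>; the witness is
  \<open>F\<close> of t^(-1/2).\<close>

lemma inv_sqrt_exists:
  assumes "pos_def_mat n M"
  shows "\<exists>B. psd_mat n B \<and> M * (B * B) = 1\<^sub>m n \<and> B * B * M = 1\<^sub>m n"
proof -
  from assms have M: "M \<in> carrier_mat n n" and sym: "transpose_mat M = M"
    and pos: "\<And>x. x \<in> carrier_vec n \<Longrightarrow> x \<noteq> 0\<^sub>v n \<Longrightarrow> 0 < x \<bullet> (M *\<^sub>v x)"
    unfolding pos_def_mat_def by auto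
  obtain P Q J where wit: "similar_mat_wit M J P Q" and diag: "diagonal_mat J"
    using symmetric_diagonalization[OF M sym] by blast
  note w = similar_mat_witD2[OF M wit]
  note assoc = assoc_mult_mat[of _ n n _ n _ n]
  note [simp] = mult_carrier_mat[of _ n n _ n]
  define d where "d i = J $$ (i, i)" for i
  define D where "D g = mat n n (\<lambda>(i, j). if i = j then g (d i) else 0)" for g :: "real \<Rightarrow> real"
  define F where "F g = P * (D g * Q)" for g :: "real \<Rightarrow> real"
  have D: "D g \<in> carrier_mat n n" for g unfolding D_def by simp
  have F: "F g \<in> carrier_mat n n" for g unfolding F_def by (intro mult_carrier_mat[of _ n n] w(6,7) D)
  have J: "J = D (\<lambda>t. t)"
    by (rule eq_matI) (use w(5) diag in \<open>auto simp: D_def d_def diagonal_mat_def\<close>)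
  have DD: "D g * D h = D (\<lambda>t. g t * h t)" for g h
    by (rule eq_matI) (auto simp: D_def scalar_prod_def if_distrib[of "\<lambda>x. x * _"] if_distrib[of "\<lambda>x. _ * x"] sum.delta cong: if_cong)
  have QP: "Q * (P * X) = X" if "X \<in> carrier_mat n n" for X
    using that w(2,6,7) by (simp add: assoc[symmetric])
  have FF: "F g * F h = F (\<lambda>t. g t * h t)" for g h
  proof -
    have "F g * F h = P * (D g * (Q * (P * (D h * Q))))"
      unfolding F_def using w(6,7) D by (simp add: assoc)
    also have "\<dots> = P * (D g * D h * Q)"
      using w(6,7) D by (simp add: QP assoc)
    finally show ?thesis by (simp add: DD F_def)
  qed
  have MF: "M = F (\<lambda>t. t)"
    unfolding w(3) F_def J using w(6,7) D by (simp add: assoc)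
  \<comment> \<open>\<open>P\<close> need not be orthogonal, but \<open>P\<^sup>TP\<close> commutes with the eigenvalue matrix, hence with
    every function of it; this makes \<open>F g\<close> symmetric.\<close>
  define S where "S = transpose_mat P * P"
  have S: "S \<in> carrier_mat n n" unfolding S_def using w(6) by simp
  have PT: "transpose_mat P \<in> carrier_mat n n" and QT: "transpose_mat Q \<in> carrier_mat n n"
    using w(6,7) by auto
  have QPT: "transpose_mat P * transpose_mat Q = 1\<^sub>m n" "transpose_mat Q * transpose_mat P = 1\<^sub>m n"
    using w(1,2,6,7) by (auto simp: transpose_mult[symmetric, of _ n n _ n])
  have DT: "transpose_mat (D g) = D g" for g
    by (rule eq_matI) (auto simp: D_def)
  have "P * (J * Q) = transpose_mat Q * (J * transpose_mat P)"
  proof -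
    have "transpose_mat (P * J * Q) = transpose_mat Q * (J * transpose_mat P)"
      using w(5-7) DT by (simp add: transpose_mult[of _ n n _ n] J)
    then show ?thesis using sym w(5-7) unfolding w(3) by (simp add: assoc)
  qed
  then have "transpose_mat P * (P * (J * Q)) * P
      = transpose_mat P * (transpose_mat Q * (J * transpose_mat P)) * P"
    by simp
  moreover have "transpose_mat P * (P * (J * Q)) * P = S * J"
  proof -
    have "transpose_mat P * (P * (J * Q)) * P = S * (J * (Q * P))"
      unfolding S_def using w(5-7) PT by (simp add: assoc)
    then show ?thesis using w(2,5) S by simp
  qed
  moreover have "transpose_mat P * (transpose_mat Q * (J * transpose_mat P)) * P = J * S"
  proof -
    have "transpose_mat P * (transpose_mat Q * (J * transpose_mat P)) * P
        = transpose_mat P * transpose_mat Q * (J * (transpose_mat P * P))"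
      using w(5-7) PT QT by (simp add: assoc)
    then show ?thesis using w(5) S unfolding QPT S_def by simp
  qed
  ultimately have SJ: "S * J = J * S" by simp
  have SDi: "(S * D g) $$ (i, j) = S $$ (i, j) * g (d j)"
    and DSi: "(D g * S) $$ (i, j) = g (d i) * S $$ (i, j)" if "i < n" "j < n" for g i j
    using that S by (auto simp: D_def scalar_prod_def if_distrib[of "\<lambda>x. x * _"]
        if_distrib[of "\<lambda>x. _ * x"] sum.delta cong: if_cong)
  have SD: "S * D g = D g * S" for g
  proof (rule eq_matI)
    fix i j assume "i < dim_row (D g * S)" "j < dim_col (D g * S)"
    then have ij: "i < n" "j < n" using carrier_matD(1)[OF D[of g]] S by auto
    \<comment> \<open>Wherever \<open>S\<close> has a nonzero entry, commuting with \<open>J\<close>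
      forces \<open>d i = d j\<close>, hence \<open>g (d i) = g (d j)\<close> for every
      \<open>g\<close>.\<close>
    have "S $$ (i, j) * d j = d i * S $$ (i, j)"
      using arg_cong[OF SJ, of "\<lambda>X. X $$ (i, j)"] SDi[OF ij] DSi[OF ij] unfolding J by simp
    then show "(S * D g) $$ (i, j) = (D g * S) $$ (i, j)"
      unfolding SDi[OF ij] DSi[OF ij] by (cases "S $$ (i, j) = 0") auto
  qed (use S D[of g] in auto)
  have FT: "transpose_mat (F g) = F g" for g
  proof -
    \<comment> \<open>Inserting the identity in the form
      \<open>transpose_mat Q * transpose_mat P\<close> creates the factor \<open>S\<close>, which
      can then be moved past \<open>D g\<close>.\<close>
    have "F g = transpose_mat Q * transpose_mat P * (P * (D g * Q))"
      unfolding F_def QPT(2) using w(6,7) D by simp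
    also have "\<dots> = transpose_mat Q * (S * D g * Q)"
      unfolding S_def using w(6,7) D PT QT by (simp add: assoc)
    also have "\<dots> = transpose_mat Q * (D g * (transpose_mat P * (P * Q)))"
      unfolding SD unfolding S_def using w(6,7) D PT QT by (simp add: assoc)
    also have "\<dots> = transpose_mat Q * (D g * transpose_mat P)"
      unfolding w(1) using PT by simp
    also have "\<dots> = transpose_mat (F g)"
      unfolding F_def using w(6,7) D DT by (simp add: transpose_mult[of _ n n _ n] assoc)
    finally show ?thesis by simp
  qed
  have dpos: "0 < d i" if i: "i < n" for i
  proof -
    \<comment> \<open>Column \<open>i\<close> of \<open>P\<close> is an eigenvector of
      \<open>M\<close> for \<open>d i\<close>, so the quadratic form at \<open>x\<close> has the
      sign of \<open>d i\<close>.\<close>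
    define x where "x = P *\<^sub>v unit_vec n i"
    have x: "x \<in> carrier_vec n" unfolding x_def using w(6) by auto
    have Qx: "Q *\<^sub>v x = unit_vec n i"
      unfolding x_def using w(2,6,7) by (simp add: assoc_mult_mat_vec[symmetric, of _ n n _ n])
    have x0: "x \<noteq> 0\<^sub>v n"
    proof
      assume "x = 0\<^sub>v n"
      then have "Q *\<^sub>v x = 0\<^sub>v n" using w(7) by (intro eq_vecI) auto
      then show False using Qx i by (metis index_unit_vec(1) index_zero_vec(1) zero_neq_one)
    qed
    have "J *\<^sub>v unit_vec n i = d i \<cdot>\<^sub>v unit_vec n i"
      by (rule eq_vecI) (use i in \<open>auto simp: J D_def\<close>)
    moreover have "M *\<^sub>v x = P *\<^sub>v (J *\<^sub>v (Q *\<^sub>v x))"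
      unfolding w(3) using w(5-7) x by (simp add: assoc_mult_mat_vec[of _ n n _ n])
    ultimately have "M *\<^sub>v x = d i \<cdot>\<^sub>v x"
      unfolding Qx using mult_mat_vec[OF w(6)] by (simp add: x_def)
    then have "0 < d i * (x \<bullet> x)" using pos[OF x x0] x by simp
    moreover have "x \<bullet> x \<ge> 0" by (auto simp: scalar_prod_def intro: sum_nonneg)
    ultimately show ?thesis by (simp add: zero_less_mult_iff)
  qed
  \<comment> \<open>The eigenvalues are positive, so the value of \<open>g\<close> at 0, where the
    divisions below take their default, is irrelevant.\<close>
  have F1: "F g = 1\<^sub>m n" if "\<And>t. 0 < t \<Longrightarrow> g t = 1" for g
  proof -
    have "D g = 1\<^sub>m n" by (rule eq_matI) (use that dpos in \<open>auto simp: D_def\<close>)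
    then show ?thesis unfolding F_def using w(1,6,7) by simp
  qed
  \<comment> \<open>Splitting t^(-1/2) into two factors t^(-1/4) exhibits the witness as the square
    of a symmetric matrix, which makes it positive semidefinite.\<close>
  let ?g = "\<lambda>t. sqrt (sqrt (1 / t))" and ?h = "\<lambda>t. sqrt (sqrt (1 / t)) * sqrt (sqrt (1 / t))"
  have "psd_mat n (F ?g * F ?g)" by (rule symmetric_mult_self_psd[OF F FT])
  then have "psd_mat n (F ?h)" by (simp only: FF)
  moreover have "M * (F ?h * F ?h) = 1\<^sub>m n" "F ?h * F ?h * M = 1\<^sub>m n"
    unfolding MF FF by (rule F1; simp add: field_simps)+
  ultimately show ?thesis by blast
qed

lemma inv_sqrt_mat_props:
  assumes "pos_def_mat n M"
  defines "B \<equiv> inv_sqrt_mat M"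
  shows "psd_mat n B" "M * (B * B) = 1\<^sub>m n" "B * B * M = 1\<^sub>m n"
proof -
  have M: "M \<in> carrier_mat n n" using assms unfolding pos_def_mat_def by simp
  obtain B0 where B0: "psd_mat n B0" "M * (B0 * B0) = 1\<^sub>m n" "B0 * B0 * M = 1\<^sub>m n"
    using inv_sqrt_exists[OF assms(1)] by blast
  have "psd_mat (dim_row M) B \<and> inverts_mat M (B * B) \<and> inverts_mat (B * B) M"
    unfolding B_def inv_sqrt_mat_def
    by (rule someI[of _ B0]) (use B0 M in \<open>auto simp: inverts_mat_def psd_mat_def\<close>)
  then show "psd_mat n B" "M * (B * B) = 1\<^sub>m n" "B * B * M = 1\<^sub>m n"
    using M by (auto simp: inverts_mat_def psd_mat_def)
qed

section \<open>The quadratic form of the inverse matrix\<close>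

lemma pos_def_invertible:
  assumes "pos_def_mat n M"
  shows "invertible_mat M"
  using inv_sqrt_mat_props[OF assms] assms
  unfolding invertible_mat_def inverts_mat_def pos_def_mat_def psd_mat_def
  by (auto intro!: exI[of _ "inv_sqrt_mat M * inv_sqrt_mat M"])

text \<open>This removes the square root from later arguments: with \<open>z\<close> in the role of
  M^-1 v, the squared norm is v^T M^-1 v.\<close>

lemma norm2_inv_sqrt:
  assumes M: "pos_def_mat n M" and v: "v \<in> carrier_vec n"
  obtains z where "z \<in> carrier_vec n" "M *\<^sub>v z = v"
    "(norm2 (inv_sqrt_mat M *\<^sub>v v))\<^sup>2 = v \<bullet> z"
proof -
  define B where "B = inv_sqrt_mat M"
  note B = inv_sqrt_mat_props[OF M, folded B_def]
  have cB: "B \<in> carrier_mat n n" "transpose_mat B = B" using B(1) by (auto simp: psd_mat_def)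
  have cM: "M \<in> carrier_mat n n" using M by (auto simp: pos_def_mat_def)
  define z where "z = B *\<^sub>v (B *\<^sub>v v)"
  have z: "z \<in> carrier_vec n" unfolding z_def by (intro mult_mat_vec_carrier[OF cB(1)] v)
  have "M *\<^sub>v z = (M * (B * B)) *\<^sub>v v"
    unfolding z_def using cB cM v by (simp add: assoc_mult_mat_vec[of _ n n _ n])
  then have "M *\<^sub>v z = v" using B(2) v by simp
  moreover have "(norm2 (B *\<^sub>v v))\<^sup>2 = (B *\<^sub>v v) \<bullet> (B *\<^sub>v v)"
    unfolding norm2_def by (rule real_sqrt_pow2) (auto simp: scalar_prod_def intro: sum_nonneg)
  moreover have "\<dots> = v \<bullet> z"
    unfolding z_def using scalar_prod_symmetric_mat[OF cB v, of "B *\<^sub>v v"] cB v by auto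
  ultimately show ?thesis using that z unfolding B_def by simp
qed

lemma norm2_inv_sqrt_pos:
  assumes M: "pos_def_mat n M" and v: "v \<in> carrier_vec n" "v \<noteq> 0\<^sub>v n"
  shows "0 < norm2 (inv_sqrt_mat M *\<^sub>v v)"
proof -
  obtain z where z: "z \<in> carrier_vec n" "M *\<^sub>v z = v"
    "(norm2 (inv_sqrt_mat M *\<^sub>v v))\<^sup>2 = v \<bullet> z"
    using norm2_inv_sqrt[OF M v(1)] .
  have "z \<noteq> 0\<^sub>v n" using z(2) v M by (auto simp: pos_def_mat_def)
  then have "0 < z \<bullet> (M *\<^sub>v z)" using M z(1) by (auto simp: pos_def_mat_def)
  then have "0 < (norm2 (inv_sqrt_mat M *\<^sub>v v))\<^sup>2"
    unfolding z using comm_scalar_prod[OF v(1) z(1)] by simp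
  moreover have "0 \<le> norm2 (inv_sqrt_mat M *\<^sub>v v)"
    unfolding norm2_def by (auto simp: scalar_prod_def intro!: sum_nonneg)
  ultimately show ?thesis by (simp add: less_le)
qed

text \<open>Inversion reverses the Loewner order. The solutions \<open>y\<close> and
  \<open>z\<close> of the two linear systems are compared through one nonnegative quadratic
  form.\<close>

lemma norm2_inv_sqrt_antimono:
  assumes M: "pos_def_mat n M" and N: "pos_def_mat n N" and v: "v \<in> carrier_vec n" and r: "0 < r"
    and le: "\<And>x. x \<in> carrier_vec n \<Longrightarrow> x \<bullet> (M *\<^sub>v x) \<le> r * (x \<bullet> (N *\<^sub>v x))"
  shows "(norm2 (inv_sqrt_mat N *\<^sub>v v))\<^sup>2 \<le> r * (norm2 (inv_sqrt_mat M *\<^sub>v v))\<^sup>2"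
proof -
  obtain y where y: "y \<in> carrier_vec n" "N *\<^sub>v y = v"
    "(norm2 (inv_sqrt_mat N *\<^sub>v v))\<^sup>2 = v \<bullet> y"
    using norm2_inv_sqrt[OF N v] .
  obtain z where z: "z \<in> carrier_vec n" "M *\<^sub>v z = v"
    "(norm2 (inv_sqrt_mat M *\<^sub>v v))\<^sup>2 = v \<bullet> z"
    using norm2_inv_sqrt[OF M v] .
  have cM: "M \<in> carrier_mat n n" "transpose_mat M = M"
    and psd: "\<And>x. x \<in> carrier_vec n \<Longrightarrow> 0 \<le> x \<bullet> (M *\<^sub>v x)"
    using M by (auto simp: pos_def_mat_def)
  \<comment> \<open>Expanding the form of \<open>M\<close> at \<open>x\<close> and bounding its
    value at \<open>y\<close> by \<open>r * (v \<bullet> y)\<close> leaves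
    \<open>0 \<le> r * (r * (v \<bullet> z) - v \<bullet> y)\<close>.\<close>
  define x where "x = y - r \<cdot>\<^sub>v z"
  have x: "x \<in> carrier_vec n" unfolding x_def using y z by simp
  have My: "M *\<^sub>v y \<in> carrier_vec n" using cM y by auto
  have Mx: "M *\<^sub>v x = M *\<^sub>v y - r \<cdot>\<^sub>v v"
    unfolding x_def using cM y z by (simp add: mult_minus_distrib_mat_vec[of _ n n] mult_mat_vec)
  have zy: "z \<bullet> (M *\<^sub>v y) = v \<bullet> y"
    using scalar_prod_symmetric_mat[OF cM z(1) y(1)] z(2) by simp
  have "0 \<le> x \<bullet> (M *\<^sub>v x)" by (rule psd[OF x])
  also have "\<dots> = y \<bullet> (M *\<^sub>v y) - 2 * r * (v \<bullet> y) + r * r * (v \<bullet> z)"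
    unfolding Mx unfolding x_def using y z v My
    by (simp add: scalar_prod_minus_distrib[of _ n] minus_scalar_prod_distrib[of _ n] zy
        comm_scalar_prod[of y n v] comm_scalar_prod[of z n v] algebra_simps)
  also have "\<dots> \<le> r * (v \<bullet> y) - 2 * r * (v \<bullet> y) + r * r * (v \<bullet> z)"
    using le[OF y(1)] y v comm_scalar_prod[of y n v] by simp
  finally have "0 \<le> r * (r * (v \<bullet> z) - v \<bullet> y)" by (simp add: algebra_simps)
  then show ?thesis unfolding y z using r by (simp add: zero_le_mult_iff)
qed

section \<open>The weight matrix\<close>

lemma weight_mat_quadratic_form:
  assumes "\<And>k. k < m \<Longrightarrow> a k \<in> carrier_vec n" "x \<in> carrier_vec n"
  shows "x \<bullet> (weight_mat m n a w *\<^sub>v x) = (\<Sum>k<m. w k * (a k \<bullet> x)\<^sup>2)"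
proof -
  have "x \<bullet> (weight_mat m n a w *\<^sub>v x)
      = (\<Sum>i<n. \<Sum>j<n. \<Sum>k<m. w k * ((a k $ i * x $ i) * (a k $ j * x $ j)))"
    using assms(2)
    by (simp add: scalar_prod_def weight_mat_def sum_distrib_left sum_distrib_right ac_simps
        atLeast0LessThan)
  also have "\<dots> = (\<Sum>k<m. \<Sum>i<n. \<Sum>j<n. w k * ((a k $ i * x $ i) * (a k $ j * x $ j)))"
    by (subst sum.swap, subst sum.swap) (rule sum.swap sum.cong refl)+
  also have "\<dots> = (\<Sum>k<m. w k * (a k \<bullet> x)\<^sup>2)"
  proof (rule sum.cong[OF refl])
    fix k assume "k \<in> {..<m}"
    then have "(a k \<bullet> x)\<^sup>2 = (\<Sum>i<n. \<Sum>j<n. (a k $ i * x $ i) * (a k $ j * x $ j))"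
      using assms(2) by (simp add: scalar_prod_def power2_eq_square sum_product atLeast0LessThan)
    then show "(\<Sum>i<n. \<Sum>j<n. w k * ((a k $ i * x $ i) * (a k $ j * x $ j)))
        = w k * (a k \<bullet> x)\<^sup>2"
      by (simp only: sum_distrib_left)
  qed
  finally show ?thesis .
qed

text \<open>Writing \<open>x\<close> as a combination of the \<open>a k\<close> expresses
  \<open>x \<bullet> x\<close> through the vanishing products
  \<open>a k \<bullet> x\<close>.\<close>

lemma orthogonal_to_span_eq_0:
  fixes a :: "nat \<Rightarrow> real vec"
  assumes a: "\<And>k. k < m \<Longrightarrow> a k \<in> carrier_vec n"
    and span: "LinearCombinations.module.span class_ring (module_vec TYPE(real) n) (a ` {..<m})
      = carrier_vec n"
    and x: "x \<in> carrier_vec n" and orth: "\<And>k. k < m \<Longrightarrow> a k \<bullet> x = 0"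
  shows "x = 0\<^sub>v n"
proof -
  interpret vec_space "TYPE(real)" n .
  have ac: "a ` {..<m} \<subseteq> carrier_vec n" using a by auto
  have "x \<in> span (a ` {..<m})" using span x by simp
  then obtain b where b: "x = lincomb b (a ` {..<m})"
    using finite_in_span[of "a ` {..<m}" x] ac by auto
  have "x \<bullet> x = (\<Sum>i<n. (\<Sum>y\<in>a ` {..<m}. b y * y $ i) * x $ i)"
    using x ac by (subst (1) b) (simp add: scalar_prod_def lincomb_index atLeast0LessThan)
  also have "\<dots> = (\<Sum>y\<in>a ` {..<m}. b y * (y \<bullet> x))"
    using x by (simp add: scalar_prod_def sum_distrib_left sum_distrib_right atLeast0LessThan ac_simps) (rule sum.swap)
  also have "\<dots> = 0" using orth by (intro sum.neutral) auto
  finally show ?thesis using conjugate_square_eq_0_vec[OF x] x by (simp add: conjugate_vec_def)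
qed

text \<open>The form is a sum of the terms \<open>w k * (a k \<bullet> x)\<^sup>2\<close>, and by
  spanning one of them is positive.\<close>

lemma pos_def_weight_mat:
  fixes a :: "nat \<Rightarrow> real vec"
  assumes a: "\<And>k. k < m \<Longrightarrow> a k \<in> carrier_vec n"
    and span: "LinearCombinations.module.span class_ring (module_vec TYPE(real) n) (a ` {..<m})
      = carrier_vec n"
    and w: "\<And>k. k < m \<Longrightarrow> 0 < w k"
  shows "pos_def_mat n (weight_mat m n a w)"
  unfolding pos_def_mat_def
proof (intro conjI ballI impI)
  show "weight_mat m n a w \<in> carrier_mat n n" by (simp add: weight_mat_def)
  show "transpose_mat (weight_mat m n a w) = weight_mat m n a w"
    by (rule eq_matI) (auto simp: weight_mat_def ac_simps)
  fix x :: "real vec" assume x: "x \<in> carrier_vec n" "x \<noteq> 0\<^sub>v n"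
  then obtain k where "k < m" "a k \<bullet> x \<noteq> 0"
    using orthogonal_to_span_eq_0[of m a n x] a span by blast
  then show "0 < x \<bullet> (weight_mat m n a w *\<^sub>v x)"
    using w weight_mat_quadratic_form[of m a n x w] a x(1)
    by (auto intro!: sum_pos2[of _ k] simp: less_imp_le)
qed

section \<open>Approximate contractions of weights\<close>

text \<open>Distance at most \<open>r\<close> in the sup metric of logarithms, written
  multiplicatively. Positivity is built in, so that closeness already makes the weight matrices
  positive definite.\<close>

definition near :: "nat \<Rightarrow> real \<Rightarrow> (nat \<Rightarrow> real) \<Rightarrow> (nat \<Rightarrow> real) \<Rightarrow> bool" where
  "near m r v w \<longleftrightarrow> (\<forall>i<m. 0 < v i \<and> 0 < w i \<and> v i \<le> exp r * w i \<and> w i \<le> exp r * v i)"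

lemma near_sym: "near m r v w \<Longrightarrow> near m r w v"
  by (auto simp: near_def)

lemma near_mono:
  assumes "near m r v w" "r \<le> r'"
  shows "near m r' v w"
proof -
  have "exp r * t \<le> exp r' * t" if "0 < t" for t
    using assms(2) that by simp
  then show ?thesis using assms(1) unfolding near_def by (meson order_trans)
qed

lemma near_trans:
  assumes "near m r v w" "near m s w z"
  shows "near m (r + s) v z"
  unfolding near_def
proof (intro allI impI conjI)
  fix i assume i: "i < m"
  have *: "p \<le> exp (r + s) * t" if "p \<le> exp r * q" "q \<le> exp s * t" for p q t :: real
  proof -
    have "exp r * q \<le> exp r * (exp s * t)" using that(2) by simp
    with that(1) have "p \<le> exp r * (exp s * t)" by (rule order_trans)
    then show ?thesis by (simp add: exp_add mult.assoc)
  qed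
  show "v i \<le> exp (r + s) * z i" using * i assms unfolding near_def by blast
  have **: "p \<le> exp (r + s) * t" if "p \<le> exp s * q" "q \<le> exp r * t" for p q t :: real
  proof -
    have "exp s * q \<le> exp s * (exp r * t)" using that(2) by simp
    with that(1) have "p \<le> exp s * (exp r * t)" by (rule order_trans)
    then show ?thesis by (simp add: exp_add mult_ac)
  qed
  show "z i \<le> exp (r + s) * v i" using ** i assms unfolding near_def by blast
  show "0 < v i" "0 < z i" using i assms unfolding near_def by blast+
qed

lemma near_exists:
  assumes "\<And>i. i < m \<Longrightarrow> 0 < v i" "\<And>i. i < m \<Longrightarrow> 0 < w i"
  shows "\<exists>r\<ge>0. near m r v w"
proof -
  \<comment> \<open>The sum dominates every ratio, and r \<le> exp r.\<close>
  define r where "r = (\<Sum>i<m. v i / w i + w i / v i)"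
  have "near m r v w"
    unfolding near_def
  proof (intro allI impI conjI)
    fix i assume i: "i < m"
    show pos: "0 < v i" "0 < w i" using assms i by auto
    have "v i / w i + w i / v i \<le> r"
      unfolding r_def by (rule member_le_sum) (use i assms in \<open>auto simp: less_imp_le\<close>)
    then have "v i / w i + w i / v i \<le> exp r" using exp_ge_add_one_self[of r] by linarith
    moreover have "0 < v i / w i" "0 < w i / v i" using pos by auto
    ultimately have "v i / w i \<le> exp r" "w i / v i \<le> exp r" by linarith+
    then show "v i \<le> exp r * w i" "w i \<le> exp r * v i" using pos by (auto simp: field_simps)
  qed
  moreover have "0 \<le> r" unfolding r_def by (intro sum_nonneg) (use assms in \<open>auto simp: less_imp_le\<close>)
  ultimately show ?thesis by blast
qed

text \<open>The recursion \<open>r \<mapsto> b + \<delta> * r\<close> has the fixed point b / (1 -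
  \<delta>); the extra 1 absorbs the geometric tail, so the final bound does not depend on
  \<open>r0\<close>. The index of \<open>P\<close> allows both moving iterates and one fixed
  pair.\<close>

lemma affine_contraction_eventually:
  fixes P :: "nat \<Rightarrow> real \<Rightarrow> bool"
  assumes "0 \<le> b" "0 \<le> \<delta>" "\<delta> < 1" "0 \<le> r0" "P 0 r0"
    and step: "\<And>k r. 0 \<le> r \<Longrightarrow> P k r \<Longrightarrow> P (Suc k) (b + \<delta> * r)"
    and mono: "\<And>k r r'. P k r \<Longrightarrow> r \<le> r' \<Longrightarrow> P k r'"
  shows "\<exists>k. P k (b / (1 - \<delta>) + 1)"
proof -
  define L where "L = b / (1 - \<delta>)"
  have L: "0 \<le> L" "b + \<delta> * L = L" using assms unfolding L_def by (auto simp: field_simps)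
  have Pk: "P k (L + \<delta> ^ k * r0)" for k
  proof (induction k)
    case 0
    show ?case using mono[OF \<open>P 0 r0\<close>, of "L + r0"] L by simp
  next
    case (Suc k)
    have "0 \<le> L + \<delta> ^ k * r0" using L assms by simp
    from step[OF this Suc.IH] have "P (Suc k) ((b + \<delta> * L) + \<delta> * \<delta> ^ k * r0)"
      by (simp add: algebra_simps)
    then show ?case unfolding L(2) by simp
  qed
  obtain k where k: "\<delta> ^ k < 1 / (r0 + 1)"
    using real_arch_pow_inv[of "1 / (r0 + 1)" \<delta>] assms by auto
  have "\<delta> ^ k * r0 \<le> \<delta> ^ k * (r0 + 1)" using assms by (intro mult_left_mono) auto
  also have "\<dots> \<le> 1" using k \<open>0 \<le> r0\<close> by (simp add: field_simps)
  finally show ?thesis using mono[OF Pk[of k], of "L + 1"] unfolding L_def by auto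
qed

section \<open>Homogeneous functions of one variable\<close>

text \<open>Lower homogeneity carries positivity from one point to larger arguments, upper
  homogeneity to smaller ones.\<close>

lemma homogeneous_pos:
  assumes nonneg: "\<And>z. 0 \<le> f z" and nz: "\<exists>z>0. f z \<noteq> 0"
    and low: "lower_homogeneous \<theta> c f" and up: "upper_homogeneous u C f"
    and "0 < c" "0 < C" "0 < x"
  shows "0 < f x"
proof -
  obtain z where z: "0 < z" "f z \<noteq> 0" using nz by blast
  then have fz: "0 < f z" using nonneg[of z] by simp
  show ?thesis
  proof (cases "z \<le> x")
    case True
    then have "1 \<le> x / z" using z by simp
    then have "c * (x / z) powr \<theta> * f z \<le> f (x / z * z)"
      using low unfolding lower_homogeneous_def by blast
    moreover have "0 < c * (x / z) powr \<theta> * f z" using fz z assms by simp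
    ultimately show ?thesis using z by simp
  next
    case False
    then have "1 \<le> z / x" using assms by simp
    then have "f (z / x * x) \<le> C * (z / x) powr u * f x"
      using up unfolding upper_homogeneous_def by blast
    then have "f x \<noteq> 0" using fz assms by auto
    then show ?thesis using nonneg[of x] by simp
  qed
qed

text \<open>For t = y / x the two quotients differ by a factor between c t^(\<theta> - 2) and C t^(u
  - 2). Since 2 ln t \<le> r, each exponent contributes at most its half times
  \<open>r\<close>.\<close>

lemma homogeneous_ratio:
  assumes nonneg: "\<And>z. 0 \<le> f z"
    and low: "lower_homogeneous \<theta> c f" and up: "upper_homogeneous u C f"
    and cC: "0 < c" "0 < C" and x: "0 < x" "x \<le> y" "y\<^sup>2 \<le> exp r * x\<^sup>2"
    and K: "ln C \<le> K" "- ln c \<le> K" and \<delta>: "0 \<le> \<delta>" "1 - \<theta> / 2 \<le> \<delta>" "u / 2 - 1 \<le> \<delta>"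
  shows "f y / y\<^sup>2 \<le> exp (K + \<delta> * r) * (f x / x\<^sup>2)"
    and "f x / x\<^sup>2 \<le> exp (K + \<delta> * r) * (f y / y\<^sup>2)"
proof -
  define t where "t = y / x"
  have t: "1 \<le> t" "y = t * x" "0 < t" using x by (auto simp: t_def)
  have "t\<^sup>2 \<le> exp r" using x by (simp add: t_def power_divide field_simps)
  then have "ln (t\<^sup>2) \<le> ln (exp r)" using t by (subst ln_le_cancel_iff) auto
  then have ln_t: "0 \<le> ln t" "2 * ln t \<le> r" using t by (auto simp: ln_realpow[of t 2])
  have "\<delta> * (2 * ln t) \<le> \<delta> * r" using ln_t \<delta> by (intro mult_left_mono)
  moreover have "(u - 2) * ln t \<le> \<delta> * (2 * ln t)" "(2 - \<theta>) * ln t \<le> \<delta> * (2 * ln t)"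
    using mult_right_mono[OF \<delta>(3) ln_t(1)] mult_right_mono[OF \<delta>(2) ln_t(1)]
    by (auto simp: algebra_simps)
  ultimately have exps: "ln C + (u - 2) * ln t \<le> K + \<delta> * r" "- ln c + (2 - \<theta>) * ln t \<le> K + \<delta> * r"
    using K by linarith+
  have t2: "t\<^sup>2 = t powr 2" using t by (simp add: powr_numeral)
  have "f y / y\<^sup>2 \<le> C * t powr u * f x / y\<^sup>2"
    using up t unfolding upper_homogeneous_def by (intro divide_right_mono) auto
  also have "\<dots> = C * (t powr u / t powr 2) * (f x / x\<^sup>2)"
    unfolding t(2) power_mult_distrib t2 using x by simp
  also have "C * (t powr u / t powr 2) = exp (ln C + (u - 2) * ln t)"
    using cC t by (simp add: exp_add exp_diff powr_def left_diff_distrib)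
  also have "\<dots> * (f x / x\<^sup>2) \<le> exp (K + \<delta> * r) * (f x / x\<^sup>2)"
    using exps nonneg by (intro mult_right_mono) auto
  finally show "f y / y\<^sup>2 \<le> exp (K + \<delta> * r) * (f x / x\<^sup>2)" .
  have "c * t powr \<theta> * f x \<le> f y"
    using low t unfolding lower_homogeneous_def by auto
  then have "f x \<le> f y / (c * t powr \<theta>)" using cC t by (simp add: field_simps)
  then have "f x / x\<^sup>2 \<le> f y / (c * t powr \<theta>) / x\<^sup>2" by (intro divide_right_mono) auto
  also have "\<dots> = 1 / c * (t powr 2 / t powr \<theta>) * (f y / y\<^sup>2)"
    unfolding t(2) power_mult_distrib t2 using x t by simp
  also have "1 / c * (t powr 2 / t powr \<theta>) = exp (- ln c + (2 - \<theta>) * ln t)"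
    using cC t by (simp add: exp_add exp_diff exp_minus powr_def left_diff_distrib field_simps)
  also have "\<dots> * (f y / y\<^sup>2) \<le> exp (K + \<delta> * r) * (f y / y\<^sup>2)"
    using exps nonneg by (intro mult_right_mono) auto
  finally show "f x / x\<^sup>2 \<le> exp (K + \<delta> * r) * (f y / y\<^sup>2)" .
qed

section \<open>The weight iteration of a fixed system\<close>

locale homogeneous_system =
  fixes u \<theta> c C :: real and m n :: nat and f :: "nat \<Rightarrow> real \<Rightarrow> real" and a :: "nat \<Rightarrow> real vec"
  assumes u4: "u < 4" and \<theta>u: "\<theta> < u" and \<theta>0: "0 < \<theta>" and c0: "0 < c" and C0: "0 < C"
    and f_nonneg: "i < m \<Longrightarrow> 0 \<le> f i z"
    and f_nz: "i < m \<Longrightarrow> \<exists>z>0. f i z \<noteq> 0"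
    and f_low: "i < m \<Longrightarrow> lower_homogeneous \<theta> c (f i)"
    and f_up: "i < m \<Longrightarrow> upper_homogeneous u C (f i)"
    and a_carrier: "i < m \<Longrightarrow> a i \<in> carrier_vec n"
    and a_nz: "i < m \<Longrightarrow> a i \<noteq> 0\<^sub>v n"
    and a_span: "LinearCombinations.module.span class_ring (module_vec TYPE(real) n) (a ` {..<m})
      = carrier_vec n"
begin

definition whitened_norm :: "(nat \<Rightarrow> real) \<Rightarrow> nat \<Rightarrow> real" where
  "whitened_norm w i = norm2 (inv_sqrt_mat (weight_mat m n a w) *\<^sub>v a i)"

definition weight_step :: "real \<Rightarrow> (nat \<Rightarrow> real) \<Rightarrow> nat \<Rightarrow> real" where
  "weight_step s w i = f i (whitened_norm w i) / (s * (whitened_norm w i)\<^sup>2)"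

lemma whitened_norm_pos:
  assumes "\<And>k. k < m \<Longrightarrow> 0 < w k" "i < m"
  shows "0 < whitened_norm w i"
  unfolding whitened_norm_def
  by (rule norm2_inv_sqrt_pos[OF pos_def_weight_mat[OF a_carrier a_span assms(1)]])
    (use a_carrier a_nz assms in auto)

lemma weight_step_pos:
  assumes "\<And>k. k < m \<Longrightarrow> 0 < w k" "i < m" "0 < s"
  shows "0 < weight_step s w i"
  unfolding weight_step_def
  using whitened_norm_pos[of w i] assms
    homogeneous_pos[OF f_nonneg f_nz f_low f_up c0 C0, OF assms(2,2,2,2)] by simp

text \<open>The bound v \<le> exp r w on weights passes to the quadratic forms of the weight
  matrices and is then reversed by inversion.\<close>

lemma whitened_norm_near:
  assumes vw: "near m r v w" and i: "i < m"
  shows "(whitened_norm w i)\<^sup>2 \<le> exp r * (whitened_norm v i)\<^sup>2"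
  unfolding whitened_norm_def
proof (rule norm2_inv_sqrt_antimono)
  show "pos_def_mat n (weight_mat m n a v)" "pos_def_mat n (weight_mat m n a w)"
    using vw by (auto intro!: pos_def_weight_mat a_carrier a_span simp: near_def)
  show "a i \<in> carrier_vec n" using a_carrier i .
  show "0 < exp r" by simp
  fix x :: "real vec" assume x: "x \<in> carrier_vec n"
  have "(\<Sum>k<m. v k * (a k \<bullet> x)\<^sup>2) \<le> (\<Sum>k<m. exp r * w k * (a k \<bullet> x)\<^sup>2)"
    using vw by (intro sum_mono mult_right_mono) (auto simp: near_def)
  then show "x \<bullet> (weight_mat m n a v *\<^sub>v x) \<le> exp r * (x \<bullet> (weight_mat m n a w *\<^sub>v x))"
    using a_carrier x by (simp add: weight_mat_quadratic_form sum_distrib_left mult.assoc)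
qed

definition \<delta> :: real where "\<delta> = max (1 - \<theta> / 2) (u / 2 - 1)"
definition K :: real where "K = max 0 (max (ln C) (- ln c))"
text \<open>This constant and the next are limits of affine recursions, plus slack 1. Both depend
  only on \<open>u\<close>, \<open>\<theta>\<close>, \<open>c\<close>, \<open>C\<close>.\<close>

definition fixed_point_dist :: real where "fixed_point_dist = K / (1 - \<delta>) + 1"
definition adjacent_dist :: real where
  "adjacent_dist = (2 * fixed_point_dist + ln 2 + K) / (1 - \<delta>) + 1"

lemma \<delta>: "0 \<le> \<delta>" "\<delta> < 1" and K: "0 \<le> K"
  and fixed_point_dist: "0 \<le> fixed_point_dist" and adjacent_dist: "0 \<le> adjacent_dist"
proof -
  \<comment> \<open>The two entries of the maximum add up to (u - \<theta>) / 2 > 0, so one is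
    positive; both are below 1 by \<theta> > 0 and u < 4.\<close>
  show d: "0 \<le> \<delta>" "\<delta> < 1" unfolding \<delta>_def using u4 \<theta>u \<theta>0 by auto
  show K: "0 \<le> K" unfolding K_def by simp
  then show fixed_point_dist: "0 \<le> fixed_point_dist" unfolding fixed_point_dist_def using d by simp
  then show "0 \<le> adjacent_dist" unfolding adjacent_dist_def using d K by simp
qed

text \<open>The approximate contraction. The ratio bound wants ordered arguments, so the proof
  splits on which whitened norm is larger and uses symmetry of \<open>near\<close>.\<close>

lemma weight_step_near:
  assumes vw: "near m r v w" and s: "0 < s"
  shows "near m (K + \<delta> * r) (weight_step s v) (weight_step s w)"
  unfolding near_def
proof (intro allI impI)
  fix i assume i: "i < m"
  let ?x = "whitened_norm v i" and ?y = "whitened_norm w i"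
  let ?E = "exp (K + \<delta> * r)"
  have pos: "0 < weight_step s v i" "0 < weight_step s w i" "0 < ?x" "0 < ?y"
    using weight_step_pos[OF _ i s] whitened_norm_pos[OF _ i] vw by (auto simp: near_def)
  note ratio = homogeneous_ratio[OF f_nonneg[OF i] f_low[OF i] f_up[OF i] c0 C0, where K = K and \<delta> = \<delta>]
  have "f i ?x / ?x\<^sup>2 \<le> ?E * (f i ?y / ?y\<^sup>2) \<and> f i ?y / ?y\<^sup>2 \<le> ?E * (f i ?x / ?x\<^sup>2)"
  proof (cases "?x \<le> ?y")
    case True
    show ?thesis
      using ratio[OF pos(3) True whitened_norm_near[OF vw i]] \<delta>(1) by (auto simp: K_def \<delta>_def)
  next
    case False
    then have "?y \<le> ?x" by simp
    from ratio[OF pos(4) this whitened_norm_near[OF near_sym[OF vw] i]] show ?thesis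
      using \<delta>(1) by (auto simp: K_def \<delta>_def)
  qed
  then have "f i ?x / ?x\<^sup>2 / s \<le> ?E * (f i ?y / ?y\<^sup>2) / s"
      "f i ?y / ?y\<^sup>2 / s \<le> ?E * (f i ?x / ?x\<^sup>2) / s"
    using divide_right_mono[of _ _ s] s by (meson less_imp_le)+
  moreover have "weight_step s w i = f i (whitened_norm w i) / (whitened_norm w i)\<^sup>2 / s" for w
    by (simp add: weight_step_def)
  ultimately show "0 < weight_step s v i \<and> 0 < weight_step s w i \<and>
      weight_step s v i \<le> ?E * weight_step s w i \<and> weight_step s w i \<le> ?E * weight_step s v i"
    using pos by simp
qed

text \<open>The distance between consecutive iterates, started at the constant weight 1, obeys the
  affine recursion with b = K; no limit of the iterates is taken.\<close>

lemma near_fixed_point: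
  assumes s: "0 < s"
  shows "\<exists>w. near m fixed_point_dist w (weight_step s w)"
proof -
  define W where "W k = (weight_step s ^^ k) (\<lambda>_. 1)" for k
  have W: "W 0 = (\<lambda>_. 1)" "W (Suc k) = weight_step s (W k)" for k by (auto simp: W_def)
  obtain r0 where r0: "0 \<le> r0" "near m r0 (W 0) (W 1)"
    using near_exists[of m "W 0" "W 1"] weight_step_pos[of "W 0"] s W by auto
  have "\<exists>k. near m (K / (1 - \<delta>) + 1) (W k) (W (Suc k))"
    by (rule affine_contraction_eventually[OF K \<delta> r0(1), of "\<lambda>k r. near m r (W k) (W (Suc k))"])
      (use r0 s W weight_step_near near_mono in auto)
  then show ?thesis unfolding fixed_point_dist_def W(2) by blast
qed

text \<open>Passing from \<open>w\<close> to its image at scale 2s, to its image at scale s, to the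
  image of \<open>v\<close>, and to \<open>v\<close> turns a bound \<open>r\<close> into an affine
  bound with slope \<open>\<delta>\<close>.\<close>

lemma near_fixed_points_adjacent:
  assumes s: "0 < s" and v: "near m fixed_point_dist v (weight_step s v)"
    and w: "near m fixed_point_dist w (weight_step (2 * s) w)"
  shows "near m adjacent_dist w v"
proof -
  have pos: "0 < v i" "0 < w i" if "i < m" for i using v w that by (auto simp: near_def)
  obtain r0 where r0: "0 \<le> r0" "near m r0 w v" using near_exists[of m w v] pos by auto
  have half: "near m (ln 2) (weight_step (2 * s) w) (weight_step s w)"
    unfolding near_def
  proof (intro allI impI)
    fix i assume i: "i < m"
    have "weight_step s w i = 2 * weight_step (2 * s) w i" by (simp add: weight_step_def)
    moreover have "0 < weight_step s w i" using weight_step_pos[of w i s] pos i s by simp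
    ultimately show "0 < weight_step (2 * s) w i \<and> 0 < weight_step s w i \<and>
        weight_step (2 * s) w i \<le> exp (ln 2) * weight_step s w i \<and>
        weight_step s w i \<le> exp (ln 2) * weight_step (2 * s) w i"
      by simp
  qed
  have step: "near m ((2 * fixed_point_dist + ln 2 + K) + \<delta> * r) w v" if "near m r w v" for r
    using near_trans[OF near_trans[OF near_trans[OF w half] weight_step_near[OF that s]] near_sym[OF v]]
    by (simp add: algebra_simps)
  have "0 \<le> 2 * fixed_point_dist + ln 2 + K" using fixed_point_dist K by simp
  \<comment> \<open>Here the pair is fixed and only the bound improves; \<open>k\<close> is a dummy
    index.\<close>
  then have "\<exists>k::nat. near m ((2 * fixed_point_dist + ln 2 + K) / (1 - \<delta>) + 1) w v"
    by (rule affine_contraction_eventually[OF _ \<delta> r0(1), of _ "\<lambda>_ r. near m r w v"])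
      (rule r0(2), erule step, erule near_mono, assumption)
  then show ?thesis unfolding adjacent_dist_def by blast
qed

lemma near_fixed_point_approx_weight:
  assumes s: "0 < s" and w: "near m r w (weight_step s w)" and r: "r \<le> q"
  shows "approx_weight m n f a (exp q) s w"
  unfolding approx_weight_def Let_def whitened_norm_def[symmetric]
proof (intro conjI allI impI)
  have pos: "0 < w k" if "k < m" for k using w that by (auto simp: near_def)
  show "invertible_mat (weight_mat m n a w)"
    by (rule pos_def_invertible[OF pos_def_weight_mat[OF a_carrier a_span pos]])
  fix i assume i: "i < m"
  show wi: "0 < w i" using pos i .
  define F where "F = f i (whitened_norm w i) / (whitened_norm w i)\<^sup>2"
  have step: "weight_step s w i = F / s" by (simp add: weight_step_def F_def)
  have "w i \<le> exp q * (F / s)" "F / s \<le> exp q * w i"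
    using near_mono[OF w r] i by (auto simp: near_def step)
  then have "s / exp q \<le> F / w i" "F / w i \<le> exp q * s"
    using wi s by (auto simp: field_simps)
  then show "s / exp q \<le> f i (whitened_norm w i) / (w i * (whitened_norm w i)\<^sup>2)"
    "f i (whitened_norm w i) / (w i * (whitened_norm w i)\<^sup>2) \<le> exp q * s"
    by (simp_all add: F_def mult.commute)
qed

text \<open>The sum in the exponent dominates both distances, so one constant serves the weight
  condition and the growth condition.\<close>

lemma approx_weight_scheme_exists:
  "\<exists>w. approx_weight_scheme m n f a (exp (fixed_point_dist + adjacent_dist)) UNIV w"
proof -
  have "\<forall>j::int. \<exists>w. near m fixed_point_dist w (weight_step (2 powi j) w)"
    using near_fixed_point by simp
  then obtain w where w: "\<And>j::int. near m fixed_point_dist (w j) (weight_step (2 powi j) (w j))" by metis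
  have "near m (fixed_point_dist + adjacent_dist) (w (j + 1)) (w j)" for j
  proof -
    have "near m adjacent_dist (w (j + 1)) (w j)"
      using near_fixed_points_adjacent[OF _ w[of j], of "w (j + 1)"] w[of "j + 1"]
      by (simp add: power_int_add mult.commute)
    then show ?thesis using near_mono fixed_point_dist by simp
  qed
  then have "approx_weight_scheme m n f a (exp (fixed_point_dist + adjacent_dist)) UNIV w"
    unfolding approx_weight_scheme_def consecutive_ints_def
    using near_fixed_point_approx_weight[OF _ w] adjacent_dist by (auto simp: near_def)
  then show ?thesis by blast
qed

end

theorem theorem2p4:
  fixes u \<theta> c C :: real
  assumes "4 > u" and "u > \<theta>" and "\<theta> > 0" and "c > 0" and "C > 0"
  shows "\<exists>\<alpha>>0. \<forall>(m::nat) (n::nat) (f :: nat \<Rightarrow> real \<Rightarrow> real).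
    (\<forall>i<m. (\<forall>z. f i z \<ge> 0) \<and> (\<exists>z>0. f i z \<noteq> 0) \<and>
           lower_homogeneous \<theta> c (f i) \<and> upper_homogeneous u C (f i)) \<longrightarrow>
    (\<forall>a :: nat \<Rightarrow> real vec.
       (\<forall>i<m. a i \<in> carrier_vec n \<and> a i \<noteq> 0\<^sub>v n) \<and>
       LinearCombinations.module.span class_ring (module_vec TYPE(real) n) (a ` {..<m}) = carrier_vec n \<longrightarrow>
       (\<exists>w :: int \<Rightarrow> nat \<Rightarrow> real. approx_weight_scheme m n f a \<alpha> UNIV w))"
proof -
  \<comment> \<open>Outside the locale these constants take only \<open>u\<close>,
    \<open>\<theta>\<close>, \<open>c\<close>, \<open>C\<close> as arguments, so \<alpha> = exp q is
    chosen before \<open>m\<close>, \<open>n\<close>, \<open>f\<close> and \<open>a\<close>.\<close>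
  define q where "q = homogeneous_system.fixed_point_dist u \<theta> c C + homogeneous_system.adjacent_dist u \<theta> c C"
  have "\<exists>w. approx_weight_scheme m n f a (exp q) UNIV w"
    if "\<forall>i<m. (\<forall>z. f i z \<ge> 0) \<and> (\<exists>z>0. f i z \<noteq> 0) \<and>
           lower_homogeneous \<theta> c (f i) \<and> upper_homogeneous u C (f i)"
      "\<forall>i<m. a i \<in> carrier_vec n \<and> a i \<noteq> 0\<^sub>v n"
      "LinearCombinations.module.span class_ring (module_vec TYPE(real) n) (a ` {..<m}) = carrier_vec n"
    for m n f a
  proof -
    interpret homogeneous_system u \<theta> c C m n f a
      by unfold_locales (use assms that in auto)
    show ?thesis using approx_weight_scheme_exists unfolding q_def .
  qed
  then show ?thesis by (intro exI[of _ "exp q"]) auto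
qed

end
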